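(* Let $f_1,f_2:\mathbb{R}^n\to\mathbb{R}$ be convex functions, let $f=f_1-f_2$, assume $\inf\{f(x): x\in\mathbb{R}^n\}>-\infty$, and let $\bar{x}\in\mathbb{R}^n$ be a local minimizer of $f$ over $\mathbb{R}^n$. If $$\partial_\varepsilon f_2(\bar{x})\subseteq\partial_\varepsilon f_1(\bar{x})\quad\text{for all }\varepsilon\ge 0,$$ then $\bar{x}$ is a global minimizer of $f$ over $\mathbb{R}^n$. Otherwise, there exists a global descent direction of $f$ at $\bar{x}$.
   Context: For a convex function $g:\mathbb{R}^n\to\mathbb{R}$, $x\in\mathbb{R}^n$ and $\varepsilon\ge 0$, the $\varepsilon$-subdifferential is $\partial_\varepsilon g(x)=\{\xi\in\mathbb{R}^n: g(y)\ge g(x)+\langle \xi,y-x\rangle-\varepsilon\ \ \forall y\in\mathbb{R}^n\}$. Global descent direction: if $\bar{x}$ is a local minimizer of $f$, a direction $d\in\mathbb{R}^n$, $d\ne 0$, is called a global descent direction of $f$ at $\bar{x}$ if there exist $\bar{\alpha}>0$ and $\delta\in(0,\bar{\alpha})$ such that $f(\bar{x}+\alpha d)<f(\bar{x})$ for all $\alpha\in(\bar{\alpha}-\delta,\bar{\alpha}+\delta)$. *)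

theory Defs
  imports "HOL-Analysis.Analysis"
begin

definition eps_subdifferential ::
    "real \<Rightarrow> ('a::real_inner \<Rightarrow> real) \<Rightarrow> 'a \<Rightarrow> 'a set" where
  "eps_subdifferential \<epsilon> g x = {\<xi>. \<forall>y. g y \<ge> g x + \<xi> \<bullet> (y - x) - \<epsilon>}"

definition local_minimizer :: "('a::metric_space \<Rightarrow> real) \<Rightarrow> 'a \<Rightarrow> bool" where
  "local_minimizer f x \<longleftrightarrow> (\<exists>r>0. \<forall>y\<in>ball x r. f x \<le> f y)"

definition global_minimizer :: "('a \<Rightarrow> real) \<Rightarrow> 'a \<Rightarrow> bool" where
  "global_minimizer f x \<longleftrightarrow> (\<forall>y. f x \<le> f y)"

text \<open>The notion is only meaningful at a local minimizer, so that requirement is part of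
  the definition.\<close>

definition global_descent_direction ::
    "('a::real_normed_vector \<Rightarrow> real) \<Rightarrow> 'a \<Rightarrow> 'a \<Rightarrow> bool" where
  "global_descent_direction f x d \<longleftrightarrow>
     local_minimizer f x \<and> d \<noteq> 0 \<and>
     (\<exists>a>0. \<exists>\<delta>\<in>{0<..<a}. \<forall>\<alpha>\<in>{a - \<delta><..<a + \<delta>}. f (x + \<alpha> *\<^sub>R d) < f x)"

end

theory Submission
  imports Defs
begin

text \<open>If \<open>\<xi>\<close> is a subgradient of \<open>f2\<close> at \<open>y\<close> with linearisation gap \<open>\<epsilon>\<close> at \<open>xbar\<close>, then \<open>\<xi>\<close>
  is an \<open>\<epsilon>\<close>-subgradient of \<open>f2\<close> at \<open>xbar\<close>, and the \<open>\<epsilon>\<close>-subgradient inequality for \<open>f1\<close>, evaluated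
  at \<open>y\<close>, reads \<open>f xbar \<le> f y\<close>. Conversely, a point \<open>y\<close> where the \<open>\<epsilon>\<close>-subgradient inequality
  fails for \<open>f1\<close> satisfies \<open>f y < f xbar\<close>; since \<open>f\<close> is continuous, \<open>y - xbar\<close> is a global descent
  direction.\<close>

text \<open>The strict epigraph is used because it misses the graph of \<open>g\<close>, so a point
  \<open>(y, g y)\<close> can be separated from it.\<close>

lemma convex_strict_epigraph:
  fixes g :: "'a::real_vector \<Rightarrow> real"
  assumes "convex_on UNIV g"
  shows "convex {p. g (fst p) < snd p}"
proof (rule convexI)
  fix p q :: "'a \<times> real" and u v :: real
  assume p: "p \<in> {p. g (fst p) < snd p}" and q: "q \<in> {p. g (fst p) < snd p}"
    and uv: "0 \<le> u" "0 \<le> v" "u + v = 1"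
  have "g (u *\<^sub>R fst p + v *\<^sub>R fst q) \<le> u * g (fst p) + v * g (fst q)"
    using assms uv by (simp add: convex_on_def)
  also have "\<dots> < u * snd p + v * snd q"
  \<comment> \<open>Some weight is positive: if \<open>u = 0\<close> then \<open>v = 1\<close> and
    \<open>q\<close> gives the strict inequality, otherwise \<open>p\<close> does.\<close>
  proof (cases "u = 0")
    case True
    then show ?thesis using q uv by simp
  next
    case False
    then show ?thesis
      using p q uv by (intro add_less_le_mono mult_strict_left_mono mult_left_mono) auto
  qed
  finally show "u *\<^sub>R p + v *\<^sub>R q \<in> {p. g (fst p) < snd p}" by simp
qed

text \<open>A hyperplane with normal \<open>(a, r)\<close> separates \<open>(y, g y)\<close> from
  the strict epigraph. It is not vertical, since \<open>g\<close> is finite everywhere, and dividing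
  by \<open>r\<close> turns it into the graph of an affine minorant with slope
  \<open>- a /\<^sub>R r\<close>.\<close>

lemma convex_on_subgradient_exists:
  fixes g :: "'a::euclidean_space \<Rightarrow> real"
  assumes "convex_on UNIV g"
  obtains \<xi> where "\<And>x. g y + \<xi> \<bullet> (x - y) \<le> g x"
proof -
  let ?S = "{p. g (fst p) < snd p}"
  have "(y, g y + 1) \<in> ?S" by simp
  then have "?S \<noteq> {}" by blast
  then obtain c b where c: "c \<noteq> 0" "\<forall>p\<in>{(y, g y)}. c \<bullet> p \<le> b" "\<forall>p\<in>?S. c \<bullet> p \<ge> b"
    using separating_hyperplane_sets[of "{(y, g y)}" ?S] convex_strict_epigraph[OF assms] by auto
  obtain a r where ar: "c = (a, r)" by (cases c)
  have sep: "a \<bullet> y + r * g y \<le> a \<bullet> x + r * t" if "g x < t" for x t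
    using c(2) bspec[OF c(3), of "(x, t)"] that by (simp add: ar)
  have "0 \<le> r" using sep[of y "g y + 1"] by (simp add: algebra_simps)
  \<comment> \<open>With \<open>r = 0\<close> the map \<open>x \<mapsto> a \<bullet> x\<close> would
    be minimal at \<open>y\<close> over the whole space; the step from \<open>y\<close> to
    \<open>y - a\<close> lowers it by \<open>a \<bullet> a\<close>, so the normal would
    vanish.\<close>
  moreover have "r \<noteq> 0"
  proof
    assume "r = 0"
    then have "a \<bullet> a \<le> 0"
      using sep[of "y - a" "g (y - a) + 1"] by (simp add: inner_diff_right)
    then have "a = 0" using inner_ge_zero[of a] by (metis antisym inner_eq_zero_iff)
    then show False using c(1) \<open>r = 0\<close> by (simp add: ar zero_prod_def)
  qed
  ultimately have "0 < r" by simp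
  show thesis
  proof
    fix x
    \<comment> \<open>Separation only speaks of heights \<open>t\<close> strictly above
      \<open>g x\<close>; the bound at \<open>g x\<close> itself follows as \<open>t\<close>
      decreases to it.\<close>
    have "g y + (- a /\<^sub>R r) \<bullet> (x - y) \<le> t" if "g x < t" for t
      using sep[OF that] \<open>0 < r\<close> by (simp add: field_simps inner_diff_right)
    then show "g y + (- a /\<^sub>R r) \<bullet> (x - y) \<le> g x" by (rule dense_ge)
  qed
qed

lemma global_minimizer_diff_convex:
  fixes f1 f2 :: "'a::euclidean_space \<Rightarrow> real"
  assumes "convex_on UNIV f2"
    and sub: "\<And>\<epsilon>. 0 \<le> \<epsilon> \<Longrightarrow> eps_subdifferential \<epsilon> f2 x \<subseteq> eps_subdifferential \<epsilon> f1 x"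
  shows "global_minimizer (\<lambda>x. f1 x - f2 x) x"
  unfolding global_minimizer_def
proof
  fix y
  obtain \<xi> where \<xi>: "\<And>z. f2 y + \<xi> \<bullet> (z - y) \<le> f2 z"
    using convex_on_subgradient_exists[OF assms(1)] by blast
  define \<epsilon> where "\<epsilon> = f2 x - f2 y - \<xi> \<bullet> (x - y)"
  have "0 \<le> \<epsilon>" using \<xi>[of x] by (simp add: \<epsilon>_def)
  moreover have "\<xi> \<in> eps_subdifferential \<epsilon> f2 x"
    unfolding eps_subdifferential_def
  proof (intro CollectI allI)
    fix z
    show "f2 x + \<xi> \<bullet> (z - x) - \<epsilon> \<le> f2 z"
      using \<xi>[of z] by (simp add: \<epsilon>_def inner_diff_right)
  qed
  ultimately have "\<xi> \<in> eps_subdifferential \<epsilon> f1 x" using sub by blast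
  then have "f1 x + \<xi> \<bullet> (y - x) - \<epsilon> \<le> f1 y" by (simp add: eps_subdifferential_def)
  then show "f1 x - f2 x \<le> f1 y - f2 y" by (simp add: \<epsilon>_def inner_diff_right)
qed

lemma eps_subdifferential_not_subset_less:
  assumes "\<not> eps_subdifferential \<epsilon> f2 x \<subseteq> eps_subdifferential \<epsilon> f1 x"
  obtains y where "f1 y - f2 y < f1 x - f2 x"
proof -
  obtain \<xi> where \<xi>: "\<And>z. f2 x + \<xi> \<bullet> (z - x) - \<epsilon> \<le> f2 z"
    and "\<xi> \<notin> eps_subdifferential \<epsilon> f1 x"
    using assms unfolding eps_subdifferential_def by blast
  then obtain y where "f1 y < f1 x + \<xi> \<bullet> (y - x) - \<epsilon>"
    by (auto simp: eps_subdifferential_def not_le)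
  \<comment> \<open>Both inequalities at \<open>y\<close> carry the same term
    \<open>\<xi> \<bullet> (y - x) - \<epsilon>\<close>, which cancels on subtraction.\<close>
  with \<xi>[of y] show thesis by (intro that[of y]) simp
qed

lemma global_descent_direction_diff:
  fixes f :: "'a::real_normed_vector \<Rightarrow> real"
  assumes cont: "continuous_on UNIV f" and "local_minimizer f x" and less: "f y < f x"
  shows "global_descent_direction f x (y - x)"
proof -
  let ?h = "\<lambda>\<alpha>. f (x + \<alpha> *\<^sub>R (y - x))"
  have "continuous_on UNIV ?h"
    by (rule continuous_on_compose2[OF cont]) (auto intro!: continuous_intros)
  then have "open {\<alpha>. ?h \<alpha> < f x}"
    by (intro open_Collect_less) auto
  moreover have "1 \<in> {\<alpha>. ?h \<alpha> < f x}" using less by simp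
  ultimately obtain e where e: "0 < e" "ball 1 e \<subseteq> {\<alpha>. ?h \<alpha> < f x}"
    by (meson openE)
  \<comment> \<open>The interval is centred at step size \<open>1\<close>, which reaches
    \<open>y\<close>; the cap \<open>1/2\<close> ensures \<open>\<delta> < 1\<close>, as the
    definition demands.\<close>
  let ?\<delta> = "min e (1/2)"
  have "?h \<alpha> < f x" if "\<alpha> \<in> {1 - ?\<delta><..<1 + ?\<delta>}" for \<alpha>
  proof -
    have "\<alpha> \<in> ball 1 e" using that by (auto simp: dist_real_def)
    then show ?thesis using e(2) by blast
  qed
  moreover have "?\<delta> \<in> {0<..<1}" using e(1) by auto
  ultimately have "\<exists>a>0. \<exists>\<delta>\<in>{0<..<a}. \<forall>\<alpha>\<in>{a - \<delta><..<a + \<delta>}. ?h \<alpha> < f x"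
    by (intro exI[of _ 1] conjI bexI[of _ ?\<delta>]) auto
  then show ?thesis
    using assms by (auto simp: global_descent_direction_def)
qed

theorem theorem2:
  fixes f1 f2 f :: "real ^ 'n \<Rightarrow> real" and xbar :: "real ^ 'n"
  assumes "convex_on UNIV f1" and "convex_on UNIV f2"
    and "f = (\<lambda>x. f1 x - f2 x)"
    and "(INF x. ereal (f x)) > -\<infinity>"
    and "local_minimizer f xbar"
  shows "((\<forall>\<epsilon>\<ge>0. eps_subdifferential \<epsilon> f2 xbar \<subseteq> eps_subdifferential \<epsilon> f1 xbar)
            \<longrightarrow> global_minimizer f xbar) \<and>
         (\<not> (\<forall>\<epsilon>\<ge>0. eps_subdifferential \<epsilon> f2 xbar \<subseteq> eps_subdifferential \<epsilon> f1 xbar)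
            \<longrightarrow> (\<exists>d. global_descent_direction f xbar d))"
proof (intro conjI impI)
  assume "\<forall>\<epsilon>\<ge>0. eps_subdifferential \<epsilon> f2 xbar \<subseteq> eps_subdifferential \<epsilon> f1 xbar"
  then show "global_minimizer f xbar"
    using global_minimizer_diff_convex[OF assms(2)] by (simp add: assms(3))
next
  assume "\<not> (\<forall>\<epsilon>\<ge>0. eps_subdifferential \<epsilon> f2 xbar \<subseteq> eps_subdifferential \<epsilon> f1 xbar)"
  then obtain y where "f y < f xbar"
    unfolding assms(3) by (meson eps_subdifferential_not_subset_less)
  \<comment> \<open>A finite convex function on an open set in finite dimension is continuous, hence
    so is the difference.\<close>
  moreover have "continuous_on UNIV f"
    unfolding assms(3) using assms(1,2)
    by (intro continuous_on_diff convex_on_continuous) auto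
  ultimately show "\<exists>d. global_descent_direction f xbar d"
    using global_descent_direction_diff assms(5) by blast
qed

end
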